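(* Let $J\subsetneq I\subset S=K[x_1,\ldots,x_n]$ be monomial ideals, let $g$ and the characteristic poset $P^g_{I/J}$ be as in the context, and let $\mathcal{P}:\ P^g_{I/J}=\bigcup_{i=1}^r[c_i,d_i]$ be a partition of $P^g_{I/J}$ into intervals. Then $$\mathcal{D}(\mathcal{P}):\quad I/J=\bigoplus_{i=1}^r\Big(\bigoplus_{c}x^cK[Z_{d_i}]\Big)$$ is a Stanley decomposition of $I/J$, where for each $i$ the inner direct sum is taken over all $c\in[c_i,d_i]$ for which $c(j)=c_i(j)$ for all $j$ with $x_j\in Z_{d_i}$. Moreover, $\operatorname{sdepth}\mathcal{D}(\mathcal{P})=\min\{\rho(d_i): i=1,\ldots,r\}$.
   Context: $K$ is a field and $S=K[x_1,\ldots,x_n]$ with its $\mathbb{Z}^n$-grading. For a finitely generated $\mathbb{Z}^n$-graded $S$-module $M$, a homogeneous $u\in M$ and $Z\subset\{x_1,\ldots,x_n\}$, $uK[Z]$ denotes the $K$-subspace of $M$ generated by all $uv$ with $v$ a monomial in $K[Z]$; it is a Stanley space of dimension $|Z|$ if it is a free $K[Z]$-module. A Stanley decomposition of $M$ is a presentation $\mathcal{D}: M=\bigoplus_{i=1}^m u_iK[Z_i]$ of $M$ as a finite direct sum of Stanley spaces, as $\mathbb{Z}^n$-graded $K$-vector spaces; $\operatorname{sdepth}\mathcal{D}=\min\{|Z_i|\}$. For $a\in\mathbb{N}^n$ (with $0\in\mathbb{N}$), $x^a=x_1^{a(1)}\cdots x_n^{a(n)}$; $\mathbb{N}^n$ is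 partially ordered componentwise. Let $I$ be generated by monomials $x^{a_1},\ldots,x^{a_t}$ and $J$ by monomials $x^{b_1},\ldots,x^{b_s}$ (no $b_j$'s if $J=0$). Fix $g\in\mathbb{N}^n$ with $a_i\le g$ and $b_j\le g$ for all $i,j$. The characteristic poset of $I/J$ with respect to $g$ is $P^g_{I/J}=\{c\in\mathbb{N}^n: c\le g,\ a_i\le c \text{ for some } i,\ c\not\ge b_j\text{ for all } j\}$, a finite subposet of $\mathbb{N}^n$. For $a\le b$ in a poset $P$, $[a,b]=\{c\in P: a\le c\le b\}$ is an interval; a partition of a finite poset $P$ is a presentation $P=\bigcup_{i=1}^r[a_i,b_i]$ as a disjoint union of (nonempty) intervals. For $b\in P^g_{I/J}$ set $Z_b=\{x_j: b(j)=g(j)\}$ and $\rho(b)=|Z_b|$. The module $I/J$ is identified with the $K$-span of the monomials in $I\setminus J$. *)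

theory Defs
  imports
    "HOL-Library.Function_Algebras"
    "HOL-Library.Poly_Mapping"
    "HOL-Algebra.Algebraic_Closure_Type"
begin

section \<open>The polynomial ring\<close>

text \<open>
  The variables are indexed by a finite type \<open>'n\<close>, so that exponent vectors are functions
  \<open>'n \<Rightarrow> nat\<close>, with the componentwise order and addition.  A polynomial maps exponent
  vectors to coefficients; the multiplication of \<^type>\<open>poly_mapping\<close> is convolution.
  A set \<open>Z\<close> of variables is represented by the set of their indices.
\<close>

type_synonym ('n, 'k) mpoly = "('n \<Rightarrow> nat) \<Rightarrow>\<^sub>0 'k"

definition mpoly_ring :: "('n::finite, 'k::field) mpoly ring" where
  "mpoly_ring = ring_of_type_algebra"

definition xpow :: "('n::finite \<Rightarrow> nat) \<Rightarrow> ('n, 'k::field) mpoly" where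
  "xpow a = Poly_Mapping.single a 1"

text \<open>The subring \<open>K[Z]\<close>; in particular \<open>mpoly_subring {}\<close> is \<open>K\<close>, identified with the
  constant polynomials.\<close>

definition mpoly_subring :: "'n::finite set \<Rightarrow> ('n, 'k::field) mpoly ring" where
  "mpoly_subring Z = mpoly_ring\<lparr>carrier := {p. \<forall>a \<in> Poly_Mapping.keys p. \<forall>j. j \<notin> Z \<longrightarrow> a j = 0}\<rparr>"

definition mpoly_component :: "('n::finite \<Rightarrow> int) \<Rightarrow> ('n, 'k::field) mpoly set" where
  "mpoly_component e = {p. \<forall>a \<in> Poly_Mapping.keys p. (\<lambda>j. int (a j)) = e}"


section \<open>Graded modules\<close>

abbreviation ksubspace :: "(('n::finite, 'k::field) mpoly, 'm) module \<Rightarrow> 'm set \<Rightarrow> bool" where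
  "ksubspace M N \<equiv> submodule N (mpoly_subring {}) M"

definition kspan :: "(('n::finite, 'k::field) mpoly, 'm) module \<Rightarrow> 'm set \<Rightarrow> 'm set" where
  "kspan M U = \<Inter>{N. ksubspace M N \<and> U \<subseteq> N}"

text \<open>\<open>W\<close> is the internal direct sum of its \<open>K\<close>-subspaces \<open>N i\<close>; the index set \<open>T\<close> may be
  infinite.\<close>

definition direct_sum ::
  "(('n::finite, 'k::field) mpoly, 'm) module \<Rightarrow> 'm set \<Rightarrow> 'i set \<Rightarrow> ('i \<Rightarrow> 'm set) \<Rightarrow> bool" where
  "direct_sum M W T N \<longleftrightarrow>
     ksubspace M W \<and> (\<forall>i\<in>T. ksubspace M (N i) \<and> N i \<subseteq> W) \<and>
     (\<forall>w\<in>W. \<exists>!f. f \<in> (\<Pi>\<^sub>E i\<in>T. N i) \<and> finite {i\<in>T. f i \<noteq> \<zero>\<^bsub>M\<^esub>} \<and>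
        w = (\<Oplus>\<^bsub>M\<^esub>i\<in>{i\<in>T. f i \<noteq> \<zero>\<^bsub>M\<^esub>}. f i))"

text \<open>A finitely generated \<open>\<int>\<^sup>n\<close>-graded module over the polynomial ring; \<open>gr e\<close> is the
  homogeneous component of degree \<open>e\<close>.\<close>

definition fg_graded_module ::
  "(('n::finite, 'k::field) mpoly, 'm) module \<Rightarrow> (('n \<Rightarrow> int) \<Rightarrow> 'm set) \<Rightarrow> bool" where
  "fg_graded_module M gr \<longleftrightarrow>
     module mpoly_ring M \<and>
     direct_sum M (carrier M) UNIV gr \<and>
     (\<forall>e e' p u. p \<in> mpoly_component e \<longrightarrow> u \<in> gr e' \<longrightarrow> p \<odot>\<^bsub>M\<^esub> u \<in> gr (e + e')) \<and>
     (\<exists>U\<subseteq>carrier M. finite U \<and> (\<forall>N. submodule N mpoly_ring M \<longrightarrow> U \<subseteq> N \<longrightarrow> N = carrier M))"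

text \<open>A decomposition of graded vector spaces: the summation map from the external direct sum
  of the \<open>N i\<close> is bijective, and it is bijective in each degree.\<close>

definition graded_direct_sum ::
  "(('n::finite, 'k::field) mpoly, 'm) module \<Rightarrow> (('n \<Rightarrow> int) \<Rightarrow> 'm set) \<Rightarrow>
     'i set \<Rightarrow> ('i \<Rightarrow> 'm set) \<Rightarrow> bool" where
  "graded_direct_sum M gr T N \<longleftrightarrow>
     direct_sum M (carrier M) T N \<and> (\<forall>e. direct_sum M (gr e) T (\<lambda>i. N i \<inter> gr e))"

definition free_module :: "'a ring \<Rightarrow> ('a, 'm) module \<Rightarrow> bool" where
  "free_module R N \<longleftrightarrow> module R N \<and>
     (\<exists>B\<subseteq>carrier N. \<forall>x\<in>carrier N. \<exists>!f. f \<in> B \<rightarrow>\<^sub>E carrier R \<and>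
        finite {b\<in>B. f b \<noteq> \<zero>\<^bsub>R\<^esub>} \<and> x = (\<Oplus>\<^bsub>N\<^esub>b\<in>{b\<in>B. f b \<noteq> \<zero>\<^bsub>R\<^esub>}. f b \<odot>\<^bsub>N\<^esub> b))"


section \<open>Stanley decompositions\<close>

text \<open>The subspace \<open>uK[Z]\<close>.\<close>

definition stanley_span ::
  "(('n::finite, 'k::field) mpoly, 'm) module \<Rightarrow> 'm \<Rightarrow> 'n set \<Rightarrow> 'm set" where
  "stanley_span M u Z = kspan M {v \<odot>\<^bsub>M\<^esub> u | v. v \<in> range xpow \<inter> carrier (mpoly_subring Z)}"

text \<open>The zero space is excluded, since \<open>Z\<close> could not be recovered from it as its dimension.\<close>

definition stanley_space ::
  "(('n::finite, 'k::field) mpoly, 'm) module \<Rightarrow> (('n \<Rightarrow> int) \<Rightarrow> 'm set) \<Rightarrow>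
     'm \<Rightarrow> 'n set \<Rightarrow> bool" where
  "stanley_space M gr u Z \<longleftrightarrow>
     (\<exists>e. u \<in> gr e) \<and> u \<noteq> \<zero>\<^bsub>M\<^esub> \<and>
     free_module (mpoly_subring Z) (M\<lparr>carrier := stanley_span M u Z\<rparr>)"

text \<open>A Stanley decomposition is a finite family of pairs \<open>D i = (u\<^sub>i, Z\<^sub>i)\<close>, \<open>i \<in> T\<close>.\<close>

definition stanley_decomposition ::
  "(('n::finite, 'k::field) mpoly, 'm) module \<Rightarrow> (('n \<Rightarrow> int) \<Rightarrow> 'm set) \<Rightarrow>
     'i set \<Rightarrow> ('i \<Rightarrow> 'm \<times> 'n set) \<Rightarrow> bool" where
  "stanley_decomposition M gr T D \<longleftrightarrow>
     fg_graded_module M gr \<and> finite T \<and>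
     (\<forall>i\<in>T. stanley_space M gr (fst (D i)) (snd (D i))) \<and>
     graded_direct_sum M gr T (\<lambda>i. stanley_span M (fst (D i)) (snd (D i)))"

definition sdepth :: "'i set \<Rightarrow> ('i \<Rightarrow> 'm \<times> 'n set) \<Rightarrow> nat" where
  "sdepth T D = Min ((\<lambda>i. card (snd (D i))) ` T)"


section \<open>The module \<open>I/J\<close>\<close>

text \<open>Elements are cosets of \<open>J\<close>. The fields \<open>mult\<close> and \<open>one\<close> of the record are irrelevant for
  modules; they are those of the quotient ring.\<close>

definition quotient_module ::
  "('n::finite, 'k::field) mpoly set \<Rightarrow> ('n, 'k) mpoly set \<Rightarrow>
     (('n, 'k) mpoly, ('n, 'k) mpoly set) module" where
  "quotient_module I J =
     \<lparr>carrier = (\<lambda>p. J +>\<^bsub>mpoly_ring\<^esub> p) ` I,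
      monoid.mult = rcoset_mult mpoly_ring J,
      one = J +>\<^bsub>mpoly_ring\<^esub> \<one>\<^bsub>mpoly_ring\<^esub>,
      zero = J,
      add = set_add mpoly_ring,
      module.smult = (\<lambda>p C. \<Union>q\<in>C. J +>\<^bsub>mpoly_ring\<^esub> (p \<otimes>\<^bsub>mpoly_ring\<^esub> q))\<rparr>"

definition quotient_component ::
  "('n::finite, 'k::field) mpoly set \<Rightarrow> ('n, 'k) mpoly set \<Rightarrow>
     ('n \<Rightarrow> int) \<Rightarrow> ('n, 'k) mpoly set set" where
  "quotient_component I J e = (\<lambda>p. J +>\<^bsub>mpoly_ring\<^esub> p) ` (I \<inter> mpoly_component e)"


section \<open>The characteristic poset and its interval partitions\<close>

text \<open>\<open>A\<close> and \<open>B\<close> are the sets of exponents of the chosen monomial generators of \<open>I\<close> and \<open>J\<close>.\<close>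

definition char_poset ::
  "('n \<Rightarrow> nat) set \<Rightarrow> ('n \<Rightarrow> nat) set \<Rightarrow> ('n \<Rightarrow> nat) \<Rightarrow> ('n \<Rightarrow> nat) set" where
  "char_poset A B g = {c. c \<le> g \<and> (\<exists>a\<in>A. a \<le> c) \<and> (\<forall>b\<in>B. \<not> b \<le> c)}"

definition poset_interval :: "'a::order set \<Rightarrow> 'a \<Rightarrow> 'a \<Rightarrow> 'a set" where
  "poset_interval P a b = {c\<in>P. a \<le> c \<and> c \<le> b}"

definition interval_partition ::
  "'a::order set \<Rightarrow> nat \<Rightarrow> (nat \<Rightarrow> 'a) \<Rightarrow> (nat \<Rightarrow> 'a) \<Rightarrow> bool" where
  "interval_partition P r c d \<longleftrightarrow>
     (\<forall>i\<in>{1..r}. c i \<in> P \<and> d i \<in> P \<and> c i \<le> d i) \<and>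
     disjoint_family_on (\<lambda>i. poset_interval P (c i) (d i)) {1..r} \<and>
     P = (\<Union>i\<in>{1..r}. poset_interval P (c i) (d i))"

definition Zset :: "('n \<Rightarrow> nat) \<Rightarrow> ('n \<Rightarrow> nat) \<Rightarrow> 'n set" where
  "Zset g b = {j. b j = g j}"

definition rho :: "('n \<Rightarrow> nat) \<Rightarrow> ('n \<Rightarrow> nat) \<Rightarrow> nat" where
  "rho g b = card (Zset g b)"

text \<open>The decomposition \<open>\<D>(\<P>)\<close>, with its double direct sum written as one family indexed by
  pairs \<open>(i, c')\<close>.\<close>

definition partition_index ::
  "('n \<Rightarrow> nat) set \<Rightarrow> ('n \<Rightarrow> nat) \<Rightarrow> nat \<Rightarrow> (nat \<Rightarrow> 'n \<Rightarrow> nat) \<Rightarrow>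
     (nat \<Rightarrow> 'n \<Rightarrow> nat) \<Rightarrow> (nat \<times> ('n \<Rightarrow> nat)) set" where
  "partition_index P g r c d =
     (SIGMA i:{1..r}. {c' \<in> poset_interval P (c i) (d i). \<forall>j\<in>Zset g (d i). c' j = c i j})"

definition partition_family ::
  "('n::finite, 'k::field) mpoly set \<Rightarrow> ('n \<Rightarrow> nat) \<Rightarrow> (nat \<Rightarrow> 'n \<Rightarrow> nat) \<Rightarrow>
     nat \<times> ('n \<Rightarrow> nat) \<Rightarrow> ('n, 'k) mpoly set \<times> 'n set" where
  "partition_family J g d = (\<lambda>(i, c'). (J +>\<^bsub>mpoly_ring\<^esub> xpow c', Zset g (d i)))"

end

theory Submission
  imports Defs
begin

text \<open>
  The images of the monomials with exponent in \<open>E = upset A - upset B\<close> form a \<open>K\<close>-basis of \<open>I/J\<close>,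
  so a partition of \<open>E\<close> yields a decomposition of \<open>I/J\<close> into a direct sum of spans. The homogeneous
  components are of this kind, and so is \<open>x\<^sup>c K[Z]\<close>, which belongs to the cone \<open>c + \<nat>\<^sup>Z\<close>. It remains
  to partition \<open>E\<close> into the cones of the statement. An exponent \<open>a\<close> lies in \<open>E\<close> iff \<open>inf a g\<close> lies in
  the characteristic poset, because the generators are bounded by \<open>g\<close>. The interval \<open>[c\<^sub>i, d\<^sub>i]\<close>
  containing \<open>inf a g\<close> and the vector \<open>c'\<close> that agrees with \<open>c\<^sub>i\<close> on \<open>Z\<close> (for \<open>d\<^sub>i\<close>) and with \<open>a\<close> elsewhere
  determine the only cone containing \<open>a\<close>: off \<open>Z\<close> we have \<open>d\<^sub>i(j) < g(j)\<close>, so truncating at \<open>g\<close> does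
  not change \<open>a(j)\<close>.
\<close>

section \<open>Polynomials and their supports\<close>

lemma mpoly_ring_simps [simp]:
  "carrier (mpoly_ring :: ('n::finite, 'k::field) mpoly ring) = UNIV"
  "p \<otimes>\<^bsub>mpoly_ring\<^esub> q = p * q" "p \<oplus>\<^bsub>mpoly_ring\<^esub> q = p + q"
  "\<one>\<^bsub>mpoly_ring\<^esub> = (1 :: ('n, 'k) mpoly)" "\<zero>\<^bsub>mpoly_ring\<^esub> = (0 :: ('n, 'k) mpoly)"
  by (simp_all add: mpoly_ring_def ring_of_type_algebra_def)

lemma cring_mpoly_ring: "cring mpoly_ring"
  unfolding mpoly_ring_def by (rule cring_from_type_algebra)

text \<open>The exponents of the monomials of K[Z]. In this encoding membership in K[Z] is an
  inclusion of supports.\<close>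

definition exps :: "'n::finite set \<Rightarrow> ('n \<Rightarrow> nat) set" where
  "exps Z = {e. \<forall>j. j \<notin> Z \<longrightarrow> e j = 0}"

lemma exps_empty [simp]: "exps {} = {0}"
  by (auto simp: exps_def)

lemma mpoly_subring_simps [simp]:
  "carrier (mpoly_subring Z :: ('n::finite, 'k::field) mpoly ring) = {p. Poly_Mapping.keys p \<subseteq> exps Z}"
  "p \<otimes>\<^bsub>mpoly_subring Z\<^esub> q = p * q" "p \<oplus>\<^bsub>mpoly_subring Z\<^esub> q = p + q"
  "\<one>\<^bsub>mpoly_subring Z\<^esub> = (1 :: ('n, 'k) mpoly)" "\<zero>\<^bsub>mpoly_subring Z\<^esub> = (0 :: ('n, 'k) mpoly)"
  by (auto simp: mpoly_subring_def exps_def)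

lemma keys_subset_add:
  assumes "Poly_Mapping.keys p \<subseteq> U" "Poly_Mapping.keys q \<subseteq> U"
  shows "Poly_Mapping.keys (p + q) \<subseteq> U"
  using assms keys_add[of p q] by blast

lemma keys_subset_mult:
  assumes "Poly_Mapping.keys p \<subseteq> U" "Poly_Mapping.keys q \<subseteq> V"
    and "\<And>a b. a \<in> U \<Longrightarrow> b \<in> V \<Longrightarrow> a + b \<in> T"
  shows "Poly_Mapping.keys (p * q) \<subseteq> T"
proof
  fix x assume "x \<in> Poly_Mapping.keys (p * q)"
  then obtain a b where "x = a + b" "a \<in> Poly_Mapping.keys p" "b \<in> Poly_Mapping.keys q"
    using keys_mult[of p q] by blast
  then show "x \<in> T" using assms by blast
qed

lemma keys_subset_sum:
  assumes "\<And>i. i \<in> F \<Longrightarrow> Poly_Mapping.keys (p i) \<subseteq> U"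
  shows "Poly_Mapping.keys (\<Sum>i\<in>F. p i) \<subseteq> U"
  using assms by (induction F rule: infinite_finite_induct) (simp_all add: keys_subset_add)

lemma keys_uminus: "Poly_Mapping.keys (- p) = Poly_Mapping.keys (p :: 'a \<Rightarrow>\<^sub>0 'b::ab_group_add)"
  by (auto simp: in_keys_iff)

lemma keys_subset_minus:
  assumes "Poly_Mapping.keys p \<subseteq> U" "Poly_Mapping.keys q \<subseteq> U"
  shows "Poly_Mapping.keys (p - q :: 'a \<Rightarrow>\<^sub>0 'b::ab_group_add) \<subseteq> U"
  using keys_subset_add[of p U "- q"] assms by (simp add: keys_uminus)

lemma keys_xpow [simp]: "Poly_Mapping.keys (xpow a :: ('n::finite, 'k::field) mpoly) = {a}"
  by (simp add: xpow_def)

lemma xpow_nonzero: "xpow a \<noteq> (0 :: ('n::finite, 'k::field) mpoly)"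
  by (metis insert_not_empty keys_xpow keys_zero)

lemma poly_mapping_sum_singles:
  "p = (\<Sum>a\<in>Poly_Mapping.keys p. Poly_Mapping.single a (Poly_Mapping.lookup p a))"
proof (rule poly_mapping_eqI)
  fix a
  have "(\<Sum>b\<in>Poly_Mapping.keys p. Poly_Mapping.lookup p b when b = a) =
      (\<Sum>b\<in>Poly_Mapping.keys p. if b = a then Poly_Mapping.lookup p b else 0)"
    by (simp add: when_def)
  also have "\<dots> = Poly_Mapping.lookup p a"
    by (auto simp: in_keys_iff)
  finally show "Poly_Mapping.lookup p a = Poly_Mapping.lookup
      (\<Sum>a\<in>Poly_Mapping.keys p. Poly_Mapping.single a (Poly_Mapping.lookup p a)) a"
    by (simp add: lookup_sum lookup_single)
qed

lemma single_conv_xpow: "Poly_Mapping.single a k = Poly_Mapping.single 0 k * xpow a"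
  by (simp add: xpow_def mult_single)

lemma single_eq_shift:
  assumes "a \<le> (b :: 'n::finite \<Rightarrow> nat)"
  shows "Poly_Mapping.single b (k::'k::field) = Poly_Mapping.single (b - a) k * xpow a"
proof -
  have "b - a + a = b" using assms by (auto simp: le_fun_def fun_eq_iff)
  then show ?thesis by (simp add: xpow_def mult_single)
qed

lemma lookup_mult_xpow:
  fixes h :: "('n::finite, 'k::field) mpoly"
  shows "Poly_Mapping.lookup (h * xpow c) (e + c) = Poly_Mapping.lookup h e"
proof -
  \<comment> \<open>In the convolution formula only q = c contributes, and e + c = a + c cancels to
    a = e.\<close>
  have "Sum_any (\<lambda>q. ((1::'k) when c = q) when e + c = a + q) = (1 when a = e)" for a
    by (subst when_commute) (simp add: when_def eq_commute)
  then show ?thesis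
    by (simp add: xpow_def lookup_mult lookup_single mult_when)
qed

text \<open>Multiplication by a monomial merely shifts coefficients, so none is lost. This gives the
  uniqueness half of freeness for x^c K[Z].\<close>

lemma mult_xpow_cancel: "h * xpow c = h' * xpow c \<Longrightarrow> h = h'"
  by (metis lookup_mult_xpow poly_mapping_eqI)

text \<open>The exponents of the monomials in x^c K[Z], as a translate of \<nat>^Z.\<close>

definition cone :: "('n::finite \<Rightarrow> nat) \<Rightarrow> 'n set \<Rightarrow> ('n \<Rightarrow> nat) set" where
  "cone c Z = (\<lambda>e. e + c) ` exps Z"

lemma mem_cone_iff: "a \<in> cone c Z \<longleftrightarrow> c \<le> a \<and> (\<forall>j. j \<notin> Z \<longrightarrow> a j = c j)"
proof
  assume r: "c \<le> a \<and> (\<forall>j. j \<notin> Z \<longrightarrow> a j = c j)"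
  then have "a = (a - c) + c" "a - c \<in> exps Z"
    by (auto simp: exps_def le_fun_def fun_eq_iff)
  then show "a \<in> cone c Z" unfolding cone_def by blast
qed (auto simp: cone_def exps_def le_fun_def)

text \<open>Division by x^c term by term; this is the existence half of freeness.\<close>

lemma factor_xpow:
  fixes p :: "('n::finite, 'k::field) mpoly"
  assumes "Poly_Mapping.keys p \<subseteq> cone c Z"
  obtains h where "Poly_Mapping.keys h \<subseteq> exps Z" "p = h * xpow c"
proof
  \<comment> \<open>Subtraction of exponents is truncated, but it is exact here: every exponent of p
    lies above c.\<close>
  define h where "h = (\<Sum>a\<in>Poly_Mapping.keys p. Poly_Mapping.single (a - c) (Poly_Mapping.lookup p a))"
  show "Poly_Mapping.keys h \<subseteq> exps Z"
    unfolding h_def using assms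
    by (intro keys_subset_sum) (auto simp: subset_iff mem_cone_iff exps_def)
  have "h * xpow c = (\<Sum>a\<in>Poly_Mapping.keys p. Poly_Mapping.single a (Poly_Mapping.lookup p a))"
    unfolding h_def sum_distrib_right using assms
    by (intro sum.cong refl single_eq_shift[symmetric]) (auto simp: subset_iff mem_cone_iff)
  then show "p = h * xpow c"
    using poly_mapping_sum_singles[of p] by simp
qed

lemma cring_mpoly_subring: "cring (mpoly_subring Z :: ('n::finite, 'k::field) mpoly ring)"
proof (intro cringI abelian_groupI comm_monoidI; (simp add: algebra_simps)?)
  fix p q :: "('n, 'k) mpoly"
  assume "Poly_Mapping.keys p \<subseteq> exps Z"  "Poly_Mapping.keys q \<subseteq> exps Z"
  then show "Poly_Mapping.keys (p * q) \<subseteq> exps Z" "Poly_Mapping.keys (p + q) \<subseteq> exps Z"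
    using keys_subset_mult[of p "exps Z" q "exps Z" "exps Z"]
    by (simp_all add: keys_subset_add) (simp add: exps_def)
next
  fix p :: "('n, 'k) mpoly"
  assume "Poly_Mapping.keys p \<subseteq> exps Z"
  then show "\<exists>q. Poly_Mapping.keys q \<subseteq> exps Z \<and> p + q = 0"
    by (intro exI[of _ "- p"]) (simp add: keys_uminus)
qed (auto simp: exps_def)


section \<open>Monomial ideals\<close>

text \<open>For a set of exponents of generators, the exponents of all monomials in the generated
  ideal.\<close>

definition upset :: "('a::order) set \<Rightarrow> 'a set" where
  "upset A = {c. \<exists>a\<in>A. a \<le> c}"

lemma upset_add:
  fixes a :: "'n \<Rightarrow> nat"
  shows "a \<in> upset A \<Longrightarrow> e + a \<in> upset A"
  unfolding upset_def by (auto simp: le_fun_def intro!: trans_le_add2)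

text \<open>The right-hand side is an ideal because up-sets are stable under translation, and it
  contains the generators. Conversely, each term of such a polynomial is a multiple of a
  generator.\<close>

lemma genideal_xpow:
  fixes A :: "('n::finite \<Rightarrow> nat) set"
  shows "genideal mpoly_ring (xpow ` A) = {p :: ('n, 'k::field) mpoly. Poly_Mapping.keys p \<subseteq> upset A}"
    (is "_ = ?I")
proof
  interpret cring "mpoly_ring :: ('n, 'k) mpoly ring" by (rule cring_mpoly_ring)
  have "ideal ?I mpoly_ring"
  proof (rule idealI[OF ring_axioms])
    have inv: "\<ominus>\<^bsub>mpoly_ring\<^esub> p = - p" for p :: "('n, 'k) mpoly"
      using minus_equality[of "- p" p] by simp
    show "subgroup ?I (add_monoid mpoly_ring)"
      by (rule add.subgroupI) (auto simp: inv a_inv_def[symmetric] keys_uminus intro!: exI[of _ 0] dest: keys_subset_add)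
    show "p \<otimes>\<^bsub>mpoly_ring\<^esub> q \<in> ?I" "q \<otimes>\<^bsub>mpoly_ring\<^esub> p \<in> ?I" if "q \<in> ?I" for p q :: "('n, 'k) mpoly"
      using that keys_subset_mult[of p UNIV q "upset A" "upset A"]
      by (simp_all add: upset_add mult.commute)
  qed
  moreover have "xpow ` A \<subseteq> ?I" by (auto simp: upset_def)
  ultimately show "genideal mpoly_ring (xpow ` A) \<subseteq> ?I" by (auto simp: genideal_def)
  show "?I \<subseteq> genideal mpoly_ring (xpow ` A)"
  proof
    fix p :: "('n, 'k) mpoly" assume p: "p \<in> ?I"
    let ?G = "genideal mpoly_ring (xpow ` A) :: ('n, 'k) mpoly set"
    interpret G: ideal "?G" "mpoly_ring :: ('n, 'k) mpoly ring"
      by (rule genideal_ideal) simp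
    have zero: "0 \<in> ?G" using G.zero_closed by simp
    have add: "q + q' \<in> ?G"
      if "q \<in> ?G" "q' \<in> ?G" for q q'
      using G.a_closed that by simp
    have single: "Poly_Mapping.single b k \<in> ?G" if "b \<in> upset A" for b k
    proof -
      from that obtain a where a: "a \<in> A" "a \<le> b" by (auto simp: upset_def)
      then have "xpow a \<in> ?G" by (auto simp: genideal_def)
      from G.I_l_closed[OF this, of "Poly_Mapping.single (b - a) k"] show ?thesis
        by (simp add: single_eq_shift[OF a(2)])
    qed
    have "(\<Sum>a\<in>F. Poly_Mapping.single a (Poly_Mapping.lookup p a)) \<in> ?G"
      if "finite F" "F \<subseteq> upset A" for F
      using that by (induction F rule: finite_induct) (auto intro: zero add single)
    then show "p \<in> ?G"
      using p by (subst poly_mapping_sum_singles) simp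
  qed
qed


section \<open>The quotient of two monomial ideals\<close>

text \<open>The ideals enter through their supports, so that membership is tested monomial by
  monomial. Finiteness of A provides the finite generation of I/J.\<close>

locale monomial_quotient =
  fixes A B :: "('n::finite \<Rightarrow> nat) set"
    and I J :: "('n, 'k::field) mpoly set"
  assumes finite_A: "finite A"
    and I_eq: "I = {p. Poly_Mapping.keys p \<subseteq> upset A}"
    and J_eq: "J = {p. Poly_Mapping.keys p \<subseteq> upset B}"
begin

abbreviation "M \<equiv> quotient_module I J"

section \<open>Cosets of J\<close>

definition cls :: "('n, 'k) mpoly \<Rightarrow> ('n, 'k) mpoly set" where
  "cls p = J +>\<^bsub>mpoly_ring\<^esub> p"

lemma zero_in_J: "0 \<in> J" by (simp add: J_eq)

lemma J_add: "p \<in> J \<Longrightarrow> q \<in> J \<Longrightarrow> p + q \<in> J"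
  by (simp add: J_eq keys_subset_add)

lemma J_minus: "p \<in> J \<Longrightarrow> q \<in> J \<Longrightarrow> p - q \<in> J"
  by (simp add: J_eq keys_subset_minus)

lemma J_mult: "q \<in> J \<Longrightarrow> p * q \<in> J"
  unfolding J_eq using keys_subset_mult[of p UNIV q "upset B" "upset B"] by (simp add: upset_add)

lemma I_add: "p \<in> I \<Longrightarrow> q \<in> I \<Longrightarrow> p + q \<in> I"
  by (simp add: I_eq keys_subset_add)

lemma I_mult: "q \<in> I \<Longrightarrow> p * q \<in> I"
  unfolding I_eq using keys_subset_mult[of p UNIV q "upset A" "upset A"] by (simp add: upset_add)

lemma cls_eq: "cls p = {q. q - p \<in> J}"
proof -
  have "q - p \<in> J \<Longrightarrow> \<exists>h\<in>J. q = h + p" for q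
    by (rule bexI[of _ "q - p"]) auto
  then show ?thesis
    by (auto simp: cls_def a_r_coset_def')
qed

lemma cls_eq_iff: "cls p = cls q \<longleftrightarrow> p - q \<in> J"
proof
  assume "cls p = cls q"
  moreover have "p \<in> cls p" by (simp add: cls_eq zero_in_J)
  ultimately show "p - q \<in> J" by (simp add: cls_eq)
next
  assume *: "p - q \<in> J"
  have "r - p \<in> J \<longleftrightarrow> r - q \<in> J" for r
    using J_add[OF _ *, of "r - p"] J_minus[OF _ *, of "r - q"] by auto
  then show "cls p = cls q" by (simp add: cls_eq)
qed

lemma cls_0: "cls 0 = J"
  by (simp add: cls_eq)

lemma carrier_M: "carrier M = cls ` I"
  by (simp add: quotient_module_def cls_def)

lemma zero_M: "\<zero>\<^bsub>M\<^esub> = cls 0"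
  by (simp add: quotient_module_def cls_0)

lemma add_M: "cls p \<oplus>\<^bsub>M\<^esub> cls q = cls (p + q)"
proof -
  \<comment> \<open>A member r of the coset of p + q is the sum of p and r - p, and the latter lies
    in the coset of q.\<close>
  have "r - (p + q) \<in> J \<Longrightarrow> \<exists>p' q'. p' - p \<in> J \<and> q' - q \<in> J \<and> r = p' + q'" for r
    by (rule exI[of _ p], rule exI[of _ "r - p"]) (simp add: zero_in_J algebra_simps)
  moreover have "p' - p \<in> J \<Longrightarrow> q' - q \<in> J \<Longrightarrow> p' + q' - (p + q) \<in> J" for p' q'
    using J_add[of "p' - p" "q' - q"] by (simp add: algebra_simps)
  ultimately show ?thesis
    by (auto simp: quotient_module_def set_add_def' cls_eq)
qed

text \<open>The module operation is a union over all representatives. J absorbs products, so the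
  united cosets coincide, and there is at least one of them because a coset is nonempty.\<close>

lemma smult_M: "p \<odot>\<^bsub>M\<^esub> cls q = cls (p * q)"
proof -
  have "cls (p * q') = cls (p * q)" if "q' \<in> cls q" for q'
    using that J_mult[of "q' - q" p] unfolding cls_eq_iff by (simp add: algebra_simps cls_eq)
  then have "(\<Union>q'\<in>cls q. cls (p * q')) = (\<Union>q'\<in>cls q. cls (p * q))"
    by (rule SUP_cong[OF refl])
  also have "cls q \<noteq> {}"
    using zero_in_J by (auto simp: cls_eq intro: exI[of _ q])
  then have "(\<Union>q'\<in>cls q. cls (p * q)) = cls (p * q)"
    by simp
  finally show ?thesis
    by (simp add: quotient_module_def cls_def[symmetric])
qed

lemma zero_in_I: "0 \<in> I" and uminus_in_I: "p \<in> I \<Longrightarrow> - p \<in> I"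
  by (simp_all add: I_eq keys_uminus)

lemma cls_in_carrier: "p \<in> I \<Longrightarrow> cls p \<in> carrier M"
  by (simp add: carrier_M)

lemma in_carrier_E:
  assumes "x \<in> carrier M" obtains p where "p \<in> I" "x = cls p"
  using assms by (auto simp: carrier_M)

section \<open>The module structure of I/J\<close>

lemma abelian_group_M: "abelian_group M"
proof (rule abelian_groupI)
  fix x y assume "x \<in> carrier M" "y \<in> carrier M"
  then obtain p q where pq: "p \<in> I" "q \<in> I" "x = cls p" "y = cls q"
    by (elim in_carrier_E)
  then show "x \<oplus>\<^bsub>M\<^esub> y \<in> carrier M"
    by (simp add: add_M cls_in_carrier I_add)
  from pq show "x \<oplus>\<^bsub>M\<^esub> y = y \<oplus>\<^bsub>M\<^esub> x"
    by (simp add: add_M add.commute)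
  fix z assume "z \<in> carrier M"
  then obtain s where "z = cls s" by (elim in_carrier_E)
  with pq show "x \<oplus>\<^bsub>M\<^esub> y \<oplus>\<^bsub>M\<^esub> z = x \<oplus>\<^bsub>M\<^esub> (y \<oplus>\<^bsub>M\<^esub> z)"
    by (simp add: add_M add.assoc)
next
  show "\<zero>\<^bsub>M\<^esub> \<in> carrier M"
    by (simp add: zero_M cls_in_carrier zero_in_I)
  fix x assume "x \<in> carrier M"
  then obtain p where p: "p \<in> I" "x = cls p" by (elim in_carrier_E)
  then show "\<zero>\<^bsub>M\<^esub> \<oplus>\<^bsub>M\<^esub> x = x"
    by (simp add: zero_M add_M)
  from p show "\<exists>y\<in>carrier M. y \<oplus>\<^bsub>M\<^esub> x = \<zero>\<^bsub>M\<^esub>"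
    by (intro bexI[of _ "cls (- p)"]) (simp_all add: cls_in_carrier zero_M add_M uminus_in_I)
qed

text \<open>Stated for any commutative ring of polynomials with the usual operations, so that S,
  every K[Z] and K itself (Z empty) are covered together.\<close>

lemma module_subring:
  assumes R: "cring R" and one: "\<one>\<^bsub>R\<^esub> = 1"
    and add: "\<And>p q. p \<oplus>\<^bsub>R\<^esub> q = p + q" and mult: "\<And>p q. p \<otimes>\<^bsub>R\<^esub> q = p * q"
  shows "module R M"
proof (rule moduleI[OF R abelian_group_M])
  fix a x y
  assume "x \<in> carrier M" "y \<in> carrier M"
  then obtain p q where "x = cls p" "y = cls q"
    by (elim in_carrier_E)
  then show "a \<odot>\<^bsub>M\<^esub> (x \<oplus>\<^bsub>M\<^esub> y) = a \<odot>\<^bsub>M\<^esub> x \<oplus>\<^bsub>M\<^esub> a \<odot>\<^bsub>M\<^esub> y"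
    by (simp add: smult_M add_M distrib_left)
next
  fix a b x
  assume "x \<in> carrier M"
  then obtain p where p: "p \<in> I" "x = cls p"
    by (elim in_carrier_E)
  then show "a \<odot>\<^bsub>M\<^esub> x \<in> carrier M"
    by (simp add: smult_M cls_in_carrier I_mult)
  from p show "(a \<oplus>\<^bsub>R\<^esub> b) \<odot>\<^bsub>M\<^esub> x = a \<odot>\<^bsub>M\<^esub> x \<oplus>\<^bsub>M\<^esub> b \<odot>\<^bsub>M\<^esub> x"
    by (simp add: smult_M add_M add distrib_right)
  from p show "(a \<otimes>\<^bsub>R\<^esub> b) \<odot>\<^bsub>M\<^esub> x = a \<odot>\<^bsub>M\<^esub> (b \<odot>\<^bsub>M\<^esub> x)"
    by (simp add: smult_M mult mult.assoc)
  from p show "\<one>\<^bsub>R\<^esub> \<odot>\<^bsub>M\<^esub> x = x"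
    by (simp add: smult_M one)
qed

lemma module_M: "module mpoly_ring M"
  by (rule module_subring[OF cring_mpoly_ring]) auto

lemma module_M_subring: "module (mpoly_subring Z) M"
  by (rule module_subring[OF cring_mpoly_subring]) auto

lemma a_inv_M: "p \<in> I \<Longrightarrow> \<ominus>\<^bsub>M\<^esub> cls p = cls (- p)"
  using abelian_group.minus_equality[OF abelian_group_M, of "cls (- p)" "cls p"]
  by (auto simp: carrier_M zero_M add_M uminus_in_I)

lemma finsum_M:
  assumes "\<And>i. i \<in> F \<Longrightarrow> p i \<in> I"
  shows "(\<Oplus>\<^bsub>M\<^esub>i\<in>F. cls (p i)) = cls (\<Sum>i\<in>F. p i)"
proof -
  interpret abelian_group M by (rule abelian_group_M)
  show ?thesis using assms
  \<comment> \<open>For infinite F both sums take their default value zero.\<close>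
  proof (induction F rule: infinite_finite_induct)
    case (insert x F)
    then have "cls (p x) \<in> carrier M" "(\<lambda>i. cls (p i)) \<in> F \<rightarrow> carrier M"
      by (auto simp: carrier_M)
    with insert show ?case by (simp add: add_M)
  qed (simp_all add: zero_M)
qed

section \<open>Spans of monomial classes\<close>

definition span_M :: "('n \<Rightarrow> nat) set \<Rightarrow> ('n, 'k) mpoly set set" where
  "span_M U = cls ` {p. Poly_Mapping.keys p \<subseteq> U}"

lemma span_M_carrier: "carrier M = span_M (upset A)"
  by (simp add: span_M_def carrier_M I_eq[symmetric])

text \<open>Terms with exponent in \<open>upset B\<close> belong to J and may be dropped from a
  representative. Together with \<open>cls_eqD\<close> this yields a normal form for elements of
  I/J.\<close>

lemma in_span_M_E:
  assumes "w \<in> span_M U"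
  obtains p where "w = cls p" "Poly_Mapping.keys p \<subseteq> U - upset B"
proof -
  from assms obtain q where q: "w = cls q" "Poly_Mapping.keys q \<subseteq> U" by (auto simp: span_M_def)
  define p where "p = Poly_Mapping.mapp (\<lambda>a k. k when a \<notin> upset B) q"
  have l: "Poly_Mapping.lookup p a = (Poly_Mapping.lookup q a when a \<notin> upset B)" for a
    by (auto simp: p_def lookup_mapp when_def in_keys_iff)
  have "q - p \<in> J"
    by (auto simp: J_eq in_keys_iff lookup_minus l when_def split: if_splits)
  then have "w = cls p" using q by (simp add: cls_eq_iff)
  moreover have "Poly_Mapping.keys p \<subseteq> U - upset B"
    using q(2) by (auto simp: in_keys_iff l subset_iff)
  ultimately show ?thesis using that by blast
qed

lemma span_M_diff: "span_M (U - upset B) = span_M U"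
  by (auto elim!: in_span_M_E) (auto simp: span_M_def)

text \<open>The difference lies in J, so its support is in \<open>upset B\<close>; but it also
  avoids \<open>upset B\<close>. Hence the classes of monomials outside J are linearly
  independent.\<close>

lemma cls_eqD:
  assumes "cls p = cls q" "Poly_Mapping.keys p \<inter> upset B = {}" "Poly_Mapping.keys q \<inter> upset B = {}"
  shows "p = q"
proof -
  have "Poly_Mapping.keys (p - q) \<subseteq> upset B"
    using assms(1) unfolding cls_eq_iff by (simp add: J_eq)
  moreover have "Poly_Mapping.keys (p - q) \<subseteq> - upset B"
    using assms by (intro keys_subset_minus) auto
  ultimately have "Poly_Mapping.keys (p - q) = {}" by blast
  then show ?thesis by simp
qed

text \<open>A common element has only one representative supported off \<open>upset B\<close>, so
  that support lies in both sets. This serves to cut Stanley spaces into homogeneous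
  components.\<close>

lemma span_M_Int:
  assumes "U \<inter> upset B = {}" "V \<inter> upset B = {}"
  shows "span_M U \<inter> span_M V = span_M (U \<inter> V)"
proof
  show "span_M U \<inter> span_M V \<subseteq> span_M (U \<inter> V)"
  proof
    fix w assume "w \<in> span_M U \<inter> span_M V"
    then obtain p q where "w = cls p" "w = cls q" "Poly_Mapping.keys p \<subseteq> U" "Poly_Mapping.keys q \<subseteq> V"
      by (auto simp: span_M_def)
    moreover from this have "p = q" using assms by (intro cls_eqD) auto
    ultimately show "w \<in> span_M (U \<inter> V)" by (auto simp: span_M_def)
  qed
qed (auto simp: span_M_def)

text \<open>The second assumption expresses stability under the monomials of K[Z]. With Z empty it
  is automatic and yields K-subspaces; for a cone it yields K[Z]-modules.\<close>

lemma submodule_span_M: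
  assumes "U \<subseteq> upset A" and "\<And>e a. e \<in> exps Z \<Longrightarrow> a \<in> U \<Longrightarrow> e + a \<in> U"
  shows "submodule (span_M U) (mpoly_subring Z) M"
proof -
  interpret module "mpoly_subring Z" M by (rule module_M_subring)
  show ?thesis
  proof (rule submoduleI)
    show "\<zero>\<^bsub>M\<^esub> \<in> span_M U"
      by (auto simp: zero_M span_M_def)
    show "\<ominus>\<^bsub>M\<^esub> a \<in> span_M U" if a: "a \<in> span_M U" for a
    proof -
      obtain p where p: "a = cls p" "Poly_Mapping.keys p \<subseteq> U" using a by (auto simp: span_M_def)
      then have "p \<in> I" using assms(1) by (auto simp: I_eq)
      with p show ?thesis by (auto simp: a_inv_M span_M_def keys_uminus)
    qed
    show "a \<oplus>\<^bsub>M\<^esub> b \<in> span_M U" if "a \<in> span_M U" "b \<in> span_M U" for a b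
    proof -
      from that obtain p q where "a = cls p" "b = cls q"
        and "Poly_Mapping.keys p \<subseteq> U" "Poly_Mapping.keys q \<subseteq> U"
        by (auto simp: span_M_def)
      then show ?thesis
        unfolding span_M_def by (simp only: add_M) (intro imageI CollectI keys_subset_add)
    qed
    show "p \<odot>\<^bsub>M\<^esub> x \<in> span_M U" if px: "p \<in> carrier (mpoly_subring Z)" "x \<in> span_M U" for p x
    proof -
      obtain q where "x = cls q" "Poly_Mapping.keys q \<subseteq> U" using px by (auto simp: span_M_def)
      moreover from this have "Poly_Mapping.keys (p * q) \<subseteq> U"
        using px(1) assms(2) by (intro keys_subset_mult[of p "exps Z" q U U]) auto
      ultimately show ?thesis
        by (simp add: smult_M span_M_def)
    qed
  qed (use assms(1) in \<open>auto simp: span_M_def span_M_carrier\<close>)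
qed

lemma ksubspace_span_M: "U \<subseteq> upset A \<Longrightarrow> ksubspace M (span_M U)"
  by (rule submodule_span_M) auto

lemma span_M_least:
  assumes "U \<subseteq> upset A" "ksubspace M N" "\<And>a. a \<in> U \<Longrightarrow> cls (xpow a) \<in> N"
  shows "span_M U \<subseteq> N"
proof
  interpret module "mpoly_subring {}" M by (rule module_M_subring)
  interpret N: submodule N "mpoly_subring {}" M by (rule assms(2))
  fix w assume "w \<in> span_M U"
  then obtain p where p: "w = cls p" "Poly_Mapping.keys p \<subseteq> U" by (auto simp: span_M_def)
  \<comment> \<open>Submodules are subgroups of the additive group in multiplicative notation:
    \<open>one_closed\<close> is about zero and \<open>m_closed\<close> about sums.\<close>
  have zero: "cls 0 \<in> N" using N.one_closed by (simp add: zero_M)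
  have add: "cls (q + q') \<in> N" if "cls q \<in> N" "cls q' \<in> N" for q q'
    using N.m_closed[OF that] by (simp add: add_M)
  have single: "cls (Poly_Mapping.single a k) \<in> N" if "a \<in> U" for a k
    using N.smult_closed[OF _ assms(3)[OF that], of "Poly_Mapping.single 0 k"]
    by (simp add: smult_M single_conv_xpow[of a k])
  have "cls (\<Sum>a\<in>F. Poly_Mapping.single a (Poly_Mapping.lookup p a)) \<in> N"
    if "finite F" "F \<subseteq> U" for F
    using that by (induction F rule: finite_induct) (auto intro: zero add single)
  from this[OF finite_keys p(2)] show "w \<in> N"
    using p(1) by (simp flip: poly_mapping_sum_singles)
qed

text \<open>Reconciles generation of subspaces with the description by supports on which the later
  arguments rest.\<close>

lemma kspan_monomials:
  assumes "U \<subseteq> upset A"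
  shows "kspan M ((\<lambda>a. cls (xpow a)) ` U) = span_M U"
proof
  show "kspan M ((\<lambda>a. cls (xpow a)) ` U) \<subseteq> span_M U"
    using ksubspace_span_M[OF assms] by (auto simp: kspan_def span_M_def)
  show "span_M U \<subseteq> kspan M ((\<lambda>a. cls (xpow a)) ` U)"
    unfolding kspan_def using span_M_least[OF assms] by (intro Inter_greatest) blast
qed

text \<open>Distribute the terms of a representative over the blocks containing their exponents;
  comparing coefficients shows that this is the only way. T may be infinite, as for the family of
  all degrees.\<close>

lemma direct_sum_span_M:
  assumes dis: "disjoint_family_on U T" and V: "V = (\<Union>i\<in>T. U i)" and sub: "V \<subseteq> upset A - upset B"
  shows "direct_sum M (span_M V) T (\<lambda>i. span_M (U i))"
  unfolding direct_sum_def
proof (intro conjI ballI)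
  show "ksubspace M (span_M V)" using sub by (intro ksubspace_span_M) auto
  show "ksubspace M (span_M (U i))" if "i \<in> T" for i
    using sub V that by (intro ksubspace_span_M) auto
  show "span_M (U i) \<subseteq> span_M V" if "i \<in> T" for i
    using V that by (auto simp: span_M_def)
next
  fix w assume "w \<in> span_M V"
  then obtain p where w: "w = cls p" and p: "Poly_Mapping.keys p \<subseteq> V" by (auto simp: span_M_def)
  \<comment> \<open>The part of p supported on the block \<open>U i\<close>.\<close>
  define q where "q i = Poly_Mapping.mapp (\<lambda>a k. k when a \<in> U i) p" for i
  have lq: "Poly_Mapping.lookup (q i) a = (Poly_Mapping.lookup p a when a \<in> U i)" for i a
    by (auto simp: q_def lookup_mapp when_def in_keys_iff)
  have kq: "Poly_Mapping.keys (q i) = Poly_Mapping.keys p \<inter> U i" for i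
    by (auto simp: in_keys_iff lq)
  \<comment> \<open>Off \<open>upset B\<close> nonzero polynomials have nonzero classes, so which
    summands vanish can be tested on polynomials.\<close>
  have cls0: "cls h = \<zero>\<^bsub>M\<^esub> \<longleftrightarrow> h = 0" if "Poly_Mapping.keys h \<subseteq> V" for h
    using that sub cls_eqD[of h 0] by (auto simp: zero_M)
  define f where "f = (\<lambda>i\<in>T. cls (q i))"
  have f0: "{i\<in>T. f i \<noteq> \<zero>\<^bsub>M\<^esub>} = {i\<in>T. q i \<noteq> 0}"
    using cls0[OF order_trans[OF _ p]] by (auto simp: f_def kq)
  have inI: "h \<in> I" if "Poly_Mapping.keys h \<subseteq> V" for h
    using that sub by (auto simp: I_eq)
  have uniq: "j = i" if "a \<in> U i" "a \<in> U j" "i \<in> T" "j \<in> T" for a i j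
    using dis that by (auto simp: disjoint_family_on_def)
  \<comment> \<open>At an exponent in \<open>U j\<close> only the summand j can contribute; if j is
    not in F, both sides vanish. This is applied to the parts \<open>q\<close> and again to an
    arbitrary competing decomposition.\<close>
  have lookup_sum_part: "Poly_Mapping.lookup (\<Sum>i\<in>F. h i) a = Poly_Mapping.lookup (h j) a"
    if "finite F" "F = {i\<in>T. h i \<noteq> 0}" "\<And>i. i \<in> T \<Longrightarrow> Poly_Mapping.keys (h i) \<subseteq> U i" "j \<in> T" "a \<in> U j"
    for F j a and h :: "_ \<Rightarrow> ('n, 'k) mpoly"
  proof -
    have "Poly_Mapping.lookup (h i) a = 0" if "i \<in> F - {j}" for i
      using uniq[of a j i] that \<open>F = _\<close> \<open>j \<in> T\<close> \<open>a \<in> U j\<close> \<open>\<And>i. i \<in> T \<Longrightarrow> Poly_Mapping.keys (h i) \<subseteq> U i\<close>[of i]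
      by (auto simp: in_keys_iff subset_iff)
    then have "Poly_Mapping.lookup (\<Sum>i\<in>F. h i) a = (\<Sum>i\<in>F. if i = j then Poly_Mapping.lookup (h i) a else 0)"
      unfolding lookup_sum by (intro sum.cong) auto
    also have "\<dots> = Poly_Mapping.lookup (h j) a"
      using that(1,2,4) by auto
    finally show ?thesis .
  qed
  \<comment> \<open>Each of the finitely many exponents of p lies in at most one block, even for
    infinite T.\<close>
  have fin: "finite {i\<in>T. q i \<noteq> 0}"
  proof (rule finite_subset)
    show "{i\<in>T. q i \<noteq> 0} \<subseteq> (\<Union>a\<in>Poly_Mapping.keys p. {i\<in>T. a \<in> U i})"
    proof
      fix i assume i: "i \<in> {i\<in>T. q i \<noteq> 0}"
      then have "Poly_Mapping.keys (q i) \<noteq> {}" by simp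
      with i show "i \<in> (\<Union>a\<in>Poly_Mapping.keys p. {i\<in>T. a \<in> U i})" by (auto simp: kq)
    qed
    have "finite {i\<in>T. a \<in> U i}" for a
    proof (cases "\<exists>i\<in>T. a \<in> U i")
      case True
      then obtain i where "i \<in> T" "a \<in> U i" by blast
      then have "{i\<in>T. a \<in> U i} \<subseteq> {i}" using uniq by blast
      then show ?thesis by (rule finite_subset) simp
    next
      case False
      then have "{i\<in>T. a \<in> U i} = {}" by blast
      then show ?thesis by (simp only: finite.emptyI)
    qed
    then show "finite (\<Union>a\<in>Poly_Mapping.keys p. {i\<in>T. a \<in> U i})" by simp
  qed
  show "\<exists>!f. f \<in> (\<Pi>\<^sub>E i\<in>T. span_M (U i)) \<and> finite {i\<in>T. f i \<noteq> \<zero>\<^bsub>M\<^esub>} \<and>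
        w = (\<Oplus>\<^bsub>M\<^esub>i\<in>{i\<in>T. f i \<noteq> \<zero>\<^bsub>M\<^esub>}. f i)"
  proof (rule ex1I[of _ f], intro conjI)
    show "f \<in> (\<Pi>\<^sub>E i\<in>T. span_M (U i))"
      by (auto simp: f_def span_M_def kq)
    show "finite {i\<in>T. f i \<noteq> \<zero>\<^bsub>M\<^esub>}" unfolding f0 by (rule fin)
    have "p = (\<Sum>i\<in>{i\<in>T. q i \<noteq> 0}. q i)"
    proof (rule poly_mapping_eqI)
      fix a
      show "Poly_Mapping.lookup p a = Poly_Mapping.lookup (\<Sum>i\<in>{i\<in>T. q i \<noteq> 0}. q i) a"
      proof (cases "a \<in> V")
        case True
        then obtain j where j: "j \<in> T" "a \<in> U j" using V by blast
        show ?thesis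
          using lookup_sum_part[OF fin refl _ j] j by (simp add: kq lq)
      next
        case False
        then have "Poly_Mapping.lookup p a = 0" using p by (auto simp: in_keys_iff)
        then show ?thesis by (simp add: lookup_sum lq)
      qed
    qed
    then have "w = cls (\<Sum>i\<in>{i\<in>T. q i \<noteq> 0}. q i)" using w by simp
    also have "\<dots> = (\<Oplus>\<^bsub>M\<^esub>i\<in>{i\<in>T. q i \<noteq> 0}. cls (q i))"
      by (rule finsum_M[symmetric]) (use p in \<open>auto intro!: inI simp: kq\<close>)
    also have "\<dots> = (\<Oplus>\<^bsub>M\<^esub>i\<in>{i\<in>T. f i \<noteq> \<zero>\<^bsub>M\<^esub>}. f i)"
      unfolding f0
    proof (rule abelian_monoid.finsum_cong'[OF abelian_group.axioms(1)[OF abelian_group_M]])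
      show "f \<in> {i\<in>T. q i \<noteq> 0} \<rightarrow> carrier M"
        using p by (auto simp: f_def kq subset_iff intro!: cls_in_carrier inI)
    qed (auto simp: f_def)
    finally show "w = (\<Oplus>\<^bsub>M\<^esub>i\<in>{i\<in>T. f i \<noteq> \<zero>\<^bsub>M\<^esub>}. f i)" .
  next
    fix f' assume f': "f' \<in> (\<Pi>\<^sub>E i\<in>T. span_M (U i)) \<and> finite {i\<in>T. f' i \<noteq> \<zero>\<^bsub>M\<^esub>} \<and>
        w = (\<Oplus>\<^bsub>M\<^esub>i\<in>{i\<in>T. f' i \<noteq> \<zero>\<^bsub>M\<^esub>}. f' i)"
    then have "f' i \<in> span_M (U i)" if "i \<in> T" for i
      using that by (auto simp: PiE_iff)
    then have "\<forall>i\<in>T. \<exists>h. f' i = cls h \<and> Poly_Mapping.keys h \<subseteq> U i"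
      unfolding span_M_def by blast
    then obtain h where h: "\<And>i. i \<in> T \<Longrightarrow> f' i = cls (h i)" "\<And>i. i \<in> T \<Longrightarrow> Poly_Mapping.keys (h i) \<subseteq> U i"
      by metis
    have hV: "Poly_Mapping.keys (h i) \<subseteq> V" if "i \<in> T" for i
      using h(2)[OF that] that V by blast
    define F where "F = {i\<in>T. h i \<noteq> 0}"
    have F: "{i\<in>T. f' i \<noteq> \<zero>\<^bsub>M\<^esub>} = F"
      unfolding F_def using h(1) cls0[OF hV] by auto
    have "w = (\<Oplus>\<^bsub>M\<^esub>i\<in>F. f' i)" using f' F by simp
    also have "\<dots> = (\<Oplus>\<^bsub>M\<^esub>i\<in>F. cls (h i))"
    proof (rule abelian_monoid.finsum_cong'[OF abelian_group.axioms(1)[OF abelian_group_M]])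
      show "(\<lambda>i. cls (h i)) \<in> F \<rightarrow> carrier M"
        using hV by (auto simp: F_def carrier_M intro!: imageI inI)
    qed (auto simp: h(1) F_def)
    also have "\<dots> = cls (\<Sum>i\<in>F. h i)"
      by (rule finsum_M) (use hV in \<open>simp add: F_def inI\<close>)
    finally have "cls p = cls (\<Sum>i\<in>F. h i)" using w by simp
    \<comment> \<open>Both polynomials are supported off \<open>upset B\<close>, so equality of
      classes lifts to polynomials, whose coefficients can be compared.\<close>
    then have ps: "p = (\<Sum>i\<in>F. h i)"
    proof (rule cls_eqD)
      have "Poly_Mapping.keys (\<Sum>i\<in>F. h i) \<subseteq> V"
        by (intro keys_subset_sum hV) (simp add: F_def)
      then show "Poly_Mapping.keys (\<Sum>i\<in>F. h i) \<inter> upset B = {}" using sub by blast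
    qed (use p sub in blast)
    have "h i = q i" if i: "i \<in> T" for i
    proof (rule poly_mapping_eqI)
      fix a
      show "Poly_Mapping.lookup (h i) a = Poly_Mapping.lookup (q i) a"
      proof (cases "a \<in> U i")
        case True
        have "finite F" using f' F by simp
        from lookup_sum_part[OF this F_def h(2) i True] True show ?thesis
          by (simp add: lq ps)
      next
        case False
        then show ?thesis using h(2)[OF i] by (auto simp: lq in_keys_iff)
      qed
    qed
    \<comment> \<open>Outside T both functions take the value \<open>undefined\<close>.\<close>
    then show "f' = f"
      using f' h(1) by (intro extensionalityI[of _ T]) (auto simp: f_def PiE_iff)
  qed
qed

section \<open>Stanley spaces of monomials\<close>

lemma stanley_span_M:
  assumes "cone c Z \<subseteq> upset A"
  shows "stanley_span M (cls (xpow c)) Z = span_M (cone c Z)"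
proof -
  have "range xpow \<inter> carrier (mpoly_subring Z) = (xpow ` exps Z :: ('n, 'k) mpoly set)"
    by auto
  \<comment> \<open>Multiplying x^c by the monomials of K[Z] produces exactly the exponents in the
    cone.\<close>
  moreover have "xpow e \<odot>\<^bsub>M\<^esub> cls (xpow c) = cls (xpow (e + c))" for e
    by (simp add: smult_M xpow_def mult_single)
  ultimately have "{v \<odot>\<^bsub>M\<^esub> cls (xpow c) |v. v \<in> range xpow \<inter> carrier (mpoly_subring Z)} =
      (\<lambda>a. cls (xpow a)) ` cone c Z"
    by (simp only: cone_def image_image Setcompr_eq_image)
  then show ?thesis by (simp add: stanley_span_def kspan_monomials[OF assms])
qed

lemma submodule_cone:
  assumes "cone c Z \<subseteq> upset A"
  shows "submodule (span_M (cone c Z)) (mpoly_subring Z) M"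
  by (rule submodule_span_M[OF assms]) (auto simp: mem_cone_iff exps_def le_fun_def intro: trans_le_add2)

text \<open>The class of x^c is a basis: \<open>factor_xpow\<close> provides the coefficient, which
  is unique because a representative supported in the cone is determined by its class and x^c can be
  cancelled.\<close>

lemma free_module_cone:
  assumes "cone c Z \<subseteq> upset A - upset B"
  shows "free_module (mpoly_subring Z) (M\<lparr>carrier := span_M (cone c Z)\<rparr>)" (is "free_module ?R ?N")
proof -
  have sub: "cone c Z \<subseteq> upset A" using assms by blast
  interpret N: module ?R ?N
    by (rule submodule.submodule_is_module[OF submodule_cone[OF sub] module_M_subring])
  define u where "u = cls (xpow c)"
  have "c \<in> cone c Z" by (simp add: mem_cone_iff)
  then have u: "u \<in> carrier ?N" by (auto simp: u_def span_M_def)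
  \<comment> \<open>The sum runs over nonzero coefficients only: it is empty when \<open>f u\<close>
    vanishes and has one term otherwise.\<close>
  have key: "(\<Oplus>\<^bsub>?N\<^esub>b\<in>{b\<in>{u}. f b \<noteq> \<zero>\<^bsub>?R\<^esub>}. f b \<odot>\<^bsub>?N\<^esub> b) = cls (f u * xpow c)"
    if "f u \<in> carrier ?R" for f
  proof (cases "f u = 0")
    case True
    then have "{b\<in>{u}. f b \<noteq> \<zero>\<^bsub>?R\<^esub>} = {}" by auto
    with True show ?thesis by (simp only: N.finsum_empty) (simp add: zero_M)
  next
    case False
    then have "{b\<in>{u}. f b \<noteq> \<zero>\<^bsub>?R\<^esub>} = {u}" by auto
    moreover have "f u \<odot>\<^bsub>?N\<^esub> u \<in> carrier ?N" using N.smult_closed[OF that u] .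
    then have "(\<Oplus>\<^bsub>?N\<^esub>b\<in>{u}. f b \<odot>\<^bsub>?N\<^esub> b) = f u \<odot>\<^bsub>?N\<^esub> u"
      by (subst N.finsum_insert) (auto simp only: finite.emptyI N.finsum_empty N.r_zero Pi_def)
    ultimately show ?thesis by (simp add: u_def smult_M)
  qed
  have "\<exists>!f. f \<in> {u} \<rightarrow>\<^sub>E carrier ?R \<and> finite {b\<in>{u}. f b \<noteq> \<zero>\<^bsub>?R\<^esub>} \<and>
      x = (\<Oplus>\<^bsub>?N\<^esub>b\<in>{b\<in>{u}. f b \<noteq> \<zero>\<^bsub>?R\<^esub>}. f b \<odot>\<^bsub>?N\<^esub> b)" if "x \<in> carrier ?N" for x
  proof -
    from that obtain p where p: "x = cls p" "Poly_Mapping.keys p \<subseteq> cone c Z"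
      by (auto simp: span_M_def)
    then obtain h where h: "Poly_Mapping.keys h \<subseteq> exps Z" "p = h * xpow c"
      using factor_xpow by blast
    have eq: "x = (\<Oplus>\<^bsub>?N\<^esub>b\<in>{b\<in>{u}. f b \<noteq> \<zero>\<^bsub>?R\<^esub>}. f b \<odot>\<^bsub>?N\<^esub> b) \<longleftrightarrow> f u = h"
      if fu: "f u \<in> carrier ?R" for f
    proof -
      have "Poly_Mapping.keys (f u * xpow c) \<subseteq> cone c Z"
        using fu by (intro keys_subset_mult[of "f u" "exps Z" "xpow c" "{c}"]) (auto simp: cone_def)
      then have "cls p = cls (f u * xpow c) \<longleftrightarrow> p = f u * xpow c"
        using cls_eqD[of p "f u * xpow c"] p(2) assms by blast
      also have "\<dots> \<longleftrightarrow> f u = h"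
        using h(2) mult_xpow_cancel by blast
      finally show ?thesis by (simp only: key[of f, OF fu] p(1))
    qed
    show ?thesis
    proof (rule ex1I[of _ "\<lambda>b\<in>{u}. h"], intro conjI)
      show "x = (\<Oplus>\<^bsub>?N\<^esub>b\<in>{b\<in>{u}. (\<lambda>b\<in>{u}. h) b \<noteq> \<zero>\<^bsub>?R\<^esub>}. (\<lambda>b\<in>{u}. h) b \<odot>\<^bsub>?N\<^esub> b)"
        using eq[of "\<lambda>b\<in>{u}. h"] h(1) by simp
    next
      fix f
      assume f: "f \<in> {u} \<rightarrow>\<^sub>E carrier ?R \<and> finite {b\<in>{u}. f b \<noteq> \<zero>\<^bsub>?R\<^esub>} \<and>
        x = (\<Oplus>\<^bsub>?N\<^esub>b\<in>{b\<in>{u}. f b \<noteq> \<zero>\<^bsub>?R\<^esub>}. f b \<odot>\<^bsub>?N\<^esub> b)"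
      then have "f u = h" using eq[of f] by blast
      with f show "f = (\<lambda>b\<in>{u}. h)"
        by (intro extensionalityI[of _ "{u}"]) (auto simp: PiE_iff)
    qed (use h(1) in \<open>auto\<close>)
  qed
  then show ?thesis
    unfolding free_module_def
    by (intro conjI exI[of _ "{u}"] ballI N.module_axioms) (use u in simp, assumption)
qed

section \<open>The grading and Stanley decompositions\<close>

lemma quotient_component_eq:
  "quotient_component I J e = span_M {a \<in> upset A - upset B. (\<lambda>j. int (a j)) = e}"
proof -
  let ?U = "{a. (\<lambda>j. int (a j)) = e}"
  have "I \<inter> mpoly_component e = {p. Poly_Mapping.keys p \<subseteq> upset A \<inter> ?U}"
    by (auto simp: I_eq mpoly_component_def)
  then have "quotient_component I J e = span_M (upset A \<inter> ?U)"
    by (simp only: quotient_component_def cls_def[symmetric] span_M_def)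
  \<comment> \<open>Monomials of J contribute only zero classes; without their exponents the results
    on disjoint blocks apply.\<close>
  also have "\<dots> = span_M (upset A \<inter> ?U - upset B)"
    by (rule span_M_diff[symmetric])
  also have "upset A \<inter> ?U - upset B = {a \<in> upset A - upset B. (\<lambda>j. int (a j)) = e}"
    by auto
  finally show ?thesis .
qed

lemma fg_graded_module_M: "fg_graded_module M (quotient_component I J)"
  unfolding fg_graded_module_def
proof (intro conjI allI impI)
  show "module mpoly_ring M" by (rule module_M)
  \<comment> \<open>The exponents in \<open>upset A - upset B\<close> are sorted by degree; degrees
    that do not occur give empty blocks and zero components.\<close>
  have "direct_sum M (span_M (upset A - upset B)) UNIV
      (\<lambda>e. span_M {a \<in> upset A - upset B. (\<lambda>j. int (a j)) = e})"
    by (rule direct_sum_span_M) (auto simp: disjoint_family_on_def)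
  then show "direct_sum M (carrier M) UNIV (quotient_component I J)"
    by (simp add: span_M_carrier span_M_diff quotient_component_eq[abs_def])
next
  fix e e' u and p :: "('n, 'k) mpoly"
  assume p: "p \<in> mpoly_component e" and "u \<in> quotient_component I J e'"
  then obtain q where q: "u = cls q" "q \<in> I" "q \<in> mpoly_component e'"
    by (auto simp: quotient_component_def cls_def)
  have "p * q \<in> mpoly_component (e + e')"
    using p q(3) keys_mult[of p q] by (fastforce simp: mpoly_component_def)
  then show "p \<odot>\<^bsub>M\<^esub> u \<in> quotient_component I J (e + e')"
    using q I_mult by (auto simp: quotient_component_def cls_def[symmetric] smult_M)
next
  have A_in_I: "xpow a \<in> I" if "a \<in> A" for a
    using that by (auto simp: I_eq upset_def)
  show "\<exists>U\<subseteq>carrier M. finite U \<and> (\<forall>N. submodule N mpoly_ring M \<longrightarrow> U \<subseteq> N \<longrightarrow> N = carrier M)"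
  proof (intro exI[of _ "(\<lambda>a. cls (xpow a)) ` A"] conjI allI impI)
    show "(\<lambda>a. cls (xpow a)) ` A \<subseteq> carrier M"
      using A_in_I by (auto intro: cls_in_carrier)
    show "finite ((\<lambda>a. cls (xpow a)) ` A)" using finite_A by simp
    fix N assume "submodule N mpoly_ring M" and gens: "(\<lambda>a. cls (xpow a)) ` A \<subseteq> N"
    then interpret N: submodule N mpoly_ring M by simp
    \<comment> \<open>An S-submodule is a K-subspace, so it suffices that N contains the classes of
      all monomials of I.\<close>
    have "ksubspace M N"
      using N.smult_closed by (intro submodule.intro N.subgroup_axioms submodule_axioms.intro) simp
    moreover have "cls (xpow b) \<in> N" if "b \<in> upset A" for b
    proof -
      from that obtain a where a: "a \<in> A" "a \<le> b" by (auto simp: upset_def)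
      then have "xpow (b - a) \<odot>\<^bsub>M\<^esub> cls (xpow a) \<in> N" using gens by (intro N.smult_closed) auto
      then show ?thesis by (simp add: smult_M xpow_def flip: single_eq_shift[OF a(2), unfolded xpow_def])
    qed
    ultimately have "carrier M \<subseteq> N" unfolding span_M_carrier by (intro span_M_least) auto
    then show "N = carrier M" using N.subset by auto
  qed
qed

lemma stanley_space_cone:
  assumes "cone c Z \<subseteq> upset A - upset B"
  shows "stanley_space M (quotient_component I J) (cls (xpow c)) Z"
  unfolding stanley_space_def
proof (intro conjI)
  \<comment> \<open>As a point of its own cone, c avoids \<open>upset B\<close>, which makes the
    class of x^c nonzero.\<close>
  have c: "c \<in> cone c Z" by (simp add: mem_cone_iff)
  then have "c \<in> upset A" "c \<notin> upset B" using assms by auto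
  then show "\<exists>e. cls (xpow c) \<in> quotient_component I J e"
    by (intro exI[of _ "\<lambda>j. int (c j)"]) (auto simp: quotient_component_eq span_M_def)
  show "cls (xpow c) \<noteq> \<zero>\<^bsub>M\<^esub>"
    using cls_eqD[of "xpow c" 0] \<open>c \<notin> upset B\<close> by (auto simp: zero_M xpow_nonzero)
  show "free_module (mpoly_subring Z) (M\<lparr>carrier := stanley_span M (cls (xpow c)) Z\<rparr>)"
    using free_module_cone[OF assms] assms by (subst stanley_span_M) auto
qed

text \<open>Here the claim becomes combinatorial: a partition of the basis exponents into cones
  suffices. The degreewise decomposition comes from intersecting each cone with the exponents of
  degree e.\<close>

lemma stanley_decomposition_cones:
  assumes "finite T" "disjoint_family_on (\<lambda>t. cone (c t) (Z t)) T"
    and cover: "upset A - upset B = (\<Union>t\<in>T. cone (c t) (Z t))"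
  shows "stanley_decomposition M (quotient_component I J) T (\<lambda>t. (cls (xpow (c t)), Z t))"
proof -
  have sub: "cone (c t) (Z t) \<subseteq> upset A - upset B" if "t \<in> T" for t
    using that cover by blast
  have span: "stanley_span M (cls (xpow (c t))) (Z t) = span_M (cone (c t) (Z t))" if "t \<in> T" for t
    using sub[OF that] by (intro stanley_span_M) blast
  \<comment> \<open>The spans are identified only for indices in T, which are all that a direct sum
    depends on.\<close>
  have cong: "direct_sum M W T N \<longleftrightarrow> direct_sum M W T N'" if "\<And>t. t \<in> T \<Longrightarrow> N t = N' t" for W N N'
    unfolding direct_sum_def using that by (simp cong: PiE_cong)
  have "direct_sum M (span_M (upset A - upset B)) T (\<lambda>t. span_M (cone (c t) (Z t)))"
    by (rule direct_sum_span_M[OF assms(2) cover order_refl])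
  then have "direct_sum M (carrier M) T (\<lambda>t. stanley_span M (cls (xpow (c t))) (Z t))"
    unfolding span_M_carrier span_M_diff by (subst cong[OF span])
  moreover have "direct_sum M (quotient_component I J e) T
      (\<lambda>t. stanley_span M (cls (xpow (c t))) (Z t) \<inter> quotient_component I J e)" for e
  proof -
    define V where "V = {a \<in> upset A - upset B. (\<lambda>j. int (a j)) = e}"
    have sum: "direct_sum M (span_M V) T (\<lambda>t. span_M (cone (c t) (Z t) \<inter> V))"
      using assms(2) by (intro direct_sum_span_M) (auto simp: disjoint_family_on_def V_def cover)
    have int: "stanley_span M (cls (xpow (c t))) (Z t) \<inter> span_M V = span_M (cone (c t) (Z t) \<inter> V)"
      if "t \<in> T" for t
      using sub[OF that] span[OF that] by (subst span_M_Int[symmetric]) (auto simp: V_def)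
    show ?thesis
      unfolding quotient_component_eq V_def[symmetric] using sum by (subst cong[OF int])
  qed
  ultimately show ?thesis
    unfolding stanley_decomposition_def graded_direct_sum_def fst_conv snd_conv
    by (intro conjI ballI allI assms(1) fg_graded_module_M stanley_space_cone sub)
qed

end


section \<open>Interval partitions and cones\<close>

text \<open>A vector below g lies below \<open>inf a g\<close> exactly when it lies below a, so
  truncation at g preserves divisibility by each generator.\<close>

lemma inf_mem_char_poset:
  fixes A B :: "('n \<Rightarrow> nat) set"
  assumes "\<forall>a\<in>A. a \<le> g" "\<forall>b\<in>B. b \<le> g"
  shows "inf a g \<in> char_poset A B g \<longleftrightarrow> a \<in> upset A - upset B"
  using assms by (auto simp: char_poset_def upset_def)

text \<open>On \<open>Zset g d\<close> the bound d equals g, which truncation respects; elsewhere a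
  agrees with c' and so stays below d. The last equation recovers the vertex c' from a, whence an
  interval contributes at most one cone through a.\<close>

lemma cone_interval:
  fixes c' :: "'n::finite \<Rightarrow> nat"
  assumes "c \<le> c'" "c' \<le> d" "d \<le> g" "\<forall>j\<in>Zset g d. c' j = c j" "a \<in> cone c' (Zset g d)"
  shows "c \<le> inf a g" "inf a g \<le> d" "c' = (\<lambda>j. if j \<in> Zset g d then c j else a j)"
proof -
  from assms have le: "c j \<le> c' j" "c' j \<le> d j" "d j \<le> g j" "c' j \<le> a j" for j
    by (auto simp: mem_cone_iff le_fun_def)
  show "c \<le> inf a g"
    unfolding le_fun_def inf_fun_def inf_nat_def using le by (meson min.boundedI order_trans)
  show "inf a g \<le> d"
  proof (rule le_funI)
    fix j show "inf a g j \<le> d j"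
      using le[of j] assms(5) by (cases "j \<in> Zset g d") (auto simp: mem_cone_iff Zset_def inf_nat_def)
  qed
  show "c' = (\<lambda>j. if j \<in> Zset g d then c j else a j)"
    using assms(4,5) by (auto simp: fun_eq_iff mem_cone_iff)
qed

text \<open>The converse, for covering: lowering a to c on \<open>Zset g d\<close> yields the vertex
  of a cone that contains a.\<close>

lemma mem_cone_of_interval:
  fixes a :: "'n::finite \<Rightarrow> nat"
  assumes "c \<le> inf a g" "inf a g \<le> d" "d \<le> g"
  defines "c' \<equiv> \<lambda>j. if j \<in> Zset g d then c j else a j"
  shows "c \<le> c'" "c' \<le> d" "a \<in> cone c' (Zset g d)"
proof -
  have le: "c j \<le> a j" "c j \<le> g j" "min (a j) (g j) \<le> d j" "d j \<le> g j" for j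
    using assms(1-3) by (auto simp: le_fun_def inf_nat_def)
  have cd: "c j \<le> d j" for j
    using le(1,2,3)[of j] by auto
  show "c \<le> c'" "a \<in> cone c' (Zset g d)"
    using le by (auto simp: c'_def le_fun_def mem_cone_iff)
  \<comment> \<open>Here \<open>d j < g j\<close>, so the minimum of \<open>a j\<close> and
    \<open>g j\<close>, being at most \<open>d j\<close>, must be \<open>a j\<close>.\<close>
  have "a j \<le> d j" if "j \<notin> Zset g d" for j
    using that le(3,4)[of j] by (auto simp: Zset_def)
  then show "c' \<le> d"
    using cd by (auto simp: c'_def le_fun_def)
qed

lemma cones_of_interval_partition:
  fixes A B :: "('n::finite \<Rightarrow> nat) set"
  assumes A: "\<forall>a\<in>A. a \<le> g" and B: "\<forall>b\<in>B. b \<le> g"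
    and part: "interval_partition (char_poset A B g) r c d"
  shows "disjoint_family_on (\<lambda>t. cone (snd t) (Zset g (d (fst t))))
      (partition_index (char_poset A B g) g r c d)" (is ?dis)
    and "upset A - upset B =
      (\<Union>t\<in>partition_index (char_poset A B g) g r c d. cone (snd t) (Zset g (d (fst t))))" (is ?cover)
proof -
  let ?P = "char_poset A B g"
  have P: "c i \<in> ?P" "d i \<in> ?P" if "i \<in> {1..r}" for i
    using part that by (auto simp: interval_partition_def)
  have dg: "d i \<le> g" if "i \<in> {1..r}" for i
    using P(2)[OF that] by (simp add: char_poset_def)
  \<comment> \<open>A generator of I dividing the monomial is inherited from \<open>c i\<close>; the
    bound g and the absence of divisors among the generators of J come from \<open>d i\<close>. So
    these intervals agree with those of \<nat>^n.\<close>
  have convex: "x \<in> ?P" if "i \<in> {1..r}" "c i \<le> x" "x \<le> d i" for i x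
    using P[OF that(1)] that(2,3) by (auto simp: char_poset_def intro: order_trans)
  have interval: "inf a g \<in> poset_interval ?P (c i) (d i)"
      "c' = (\<lambda>j. if j \<in> Zset g (d i) then c i j else a j)"
    if "(i, c') \<in> partition_index ?P g r c d" "a \<in> cone c' (Zset g (d i))" for i c' a
  proof -
    from that(1) have i: "i \<in> {1..r}" "c i \<le> c'" "c' \<le> d i" "\<forall>j\<in>Zset g (d i). c' j = c i j"
      by (auto simp: partition_index_def poset_interval_def)
    note ci = cone_interval[OF i(2,3) dg[OF i(1)] i(4) that(2)]
    show "inf a g \<in> poset_interval ?P (c i) (d i)"
      using ci(1,2) convex[OF i(1)] by (auto simp: poset_interval_def)
    show "c' = (\<lambda>j. if j \<in> Zset g (d i) then c i j else a j)" by (rule ci(3))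
  qed
  show ?dis
    unfolding disjoint_family_on_def
  proof (intro ballI impI, rule ccontr)
    fix s t
    assume s: "s \<in> partition_index ?P g r c d" and t: "t \<in> partition_index ?P g r c d" and "s \<noteq> t"
      and "cone (snd s) (Zset g (d (fst s))) \<inter> cone (snd t) (Zset g (d (fst t))) \<noteq> {}"
    then obtain a where a: "a \<in> cone (snd s) (Zset g (d (fst s)))" "a \<in> cone (snd t) (Zset g (d (fst t)))"
      by blast
    have s': "(fst s, snd s) \<in> partition_index ?P g r c d" and t': "(fst t, snd t) \<in> partition_index ?P g r c d"
      using s t by simp_all
    have "fst s \<in> {1..r}" "fst t \<in> {1..r}"
      using s t by (auto simp: partition_index_def)
    moreover have "disjoint_family_on (\<lambda>i. poset_interval ?P (c i) (d i)) {1..r}"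
      using part by (simp add: interval_partition_def)
    \<comment> \<open>A common point a truncates into both intervals, which therefore have the same
      index; index and a then determine the vertex.\<close>
    ultimately have "fst s = fst t"
      using interval(1)[OF s' a(1)] interval(1)[OF t' a(2)]
        disjoint_family_onD[of "\<lambda>i. poset_interval ?P (c i) (d i)" "{1..r}" "fst s" "fst t"] by fast
    moreover have "snd s = snd t"
      unfolding interval(2)[OF s' a(1)] interval(2)[OF t' a(2)] \<open>fst s = fst t\<close> by (rule refl)
    ultimately show False using \<open>s \<noteq> t\<close> by (simp add: prod_eq_iff)
  qed
  show ?cover
  proof (intro equalityI subsetI)
    fix a assume "a \<in> upset A - upset B"
    then have "inf a g \<in> ?P" using inf_mem_char_poset[OF A B] by blast
    then have "inf a g \<in> (\<Union>i\<in>{1..r}. poset_interval ?P (c i) (d i))"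
      using part by (simp only: interval_partition_def)
    then obtain i where i: "i \<in> {1..r}" "c i \<le> inf a g" "inf a g \<le> d i"
      unfolding poset_interval_def by blast
    \<comment> \<open>The only vertex that \<open>cone_interval\<close> allows.\<close>
    define c' where "c' = (\<lambda>j. if j \<in> Zset g (d i) then c i j else a j)"
    note m = mem_cone_of_interval[OF i(2,3) dg[OF i(1)], folded c'_def]
    have "(i, c') \<in> partition_index ?P g r c d"
      using i(1) m(1,2) convex[OF i(1)] by (auto simp: partition_index_def poset_interval_def c'_def)
    with m(3) show "a \<in> (\<Union>t\<in>partition_index ?P g r c d. cone (snd t) (Zset g (d (fst t))))"
      by force
  next
    fix a assume "a \<in> (\<Union>t\<in>partition_index ?P g r c d. cone (snd t) (Zset g (d (fst t))))"
    then obtain i c' where "(i, c') \<in> partition_index ?P g r c d" "a \<in> cone c' (Zset g (d i))"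
      by auto
    then have "inf a g \<in> ?P" using interval(1) by (auto simp: poset_interval_def)
    then show "a \<in> upset A - upset B" using inf_mem_char_poset[OF A B] by blast
  qed
qed

lemma finite_le_fun: "finite {c :: 'n::finite \<Rightarrow> nat. c \<le> g}"
proof -
  have "{c. c \<le> g} \<subseteq> (\<Pi>\<^sub>E j\<in>UNIV. {..g j})" by (auto simp: le_fun_def)
  then show ?thesis by (rule finite_subset) (auto intro: finite_PiE)
qed

theorem theorem2p1:
  fixes A B :: "('n::finite \<Rightarrow> nat) set"
    and I J :: "('n, 'k::field) mpoly set"
    and g :: "'n \<Rightarrow> nat"
    and r :: nat
    and c d :: "nat \<Rightarrow> 'n \<Rightarrow> nat"
  assumes "finite A" and "finite B"
    and "I = genideal mpoly_ring (xpow ` A)"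
    and "J = genideal mpoly_ring (xpow ` B)"
    and "J \<subset> I"
    and "\<forall>a\<in>A. a \<le> g" and "\<forall>b\<in>B. b \<le> g"
    and "interval_partition (char_poset A B g) r c d"
  shows "stanley_decomposition (quotient_module I J) (quotient_component I J)
           (partition_index (char_poset A B g) g r c d) (partition_family J g d)
       \<and> sdepth (partition_index (char_poset A B g) g r c d) (partition_family J g d)
         = Min ((\<lambda>i. rho g (d i)) ` {1..r})"
proof
  let ?T = "partition_index (char_poset A B g) g r c d"
  have I: "I = {p. Poly_Mapping.keys p \<subseteq> upset A}" and J: "J = {p. Poly_Mapping.keys p \<subseteq> upset B}"
    using assms(3,4) genideal_xpow by blast+
  interpret monomial_quotient A B I J
    by (intro monomial_quotient.intro assms(1) I J)
  have "?T \<subseteq> {1..r} \<times> {c. c \<le> g}"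
    by (auto simp: partition_index_def poset_interval_def char_poset_def)
  then have "finite ?T" by (rule finite_subset) (simp add: finite_le_fun)
  from stanley_decomposition_cones[OF this cones_of_interval_partition[OF assms(6,7,8)]]
  show "stanley_decomposition (quotient_module I J) (quotient_component I J) ?T (partition_family J g d)"
    by (simp add: partition_family_def cls_def case_prod_beta')
  \<comment> \<open>Every i occurs in the index set, through the vertex \<open>c i\<close>, so no
    \<open>rho g (d i)\<close> is missing from the minimum.\<close>
  have "(i, c i) \<in> ?T" if "i \<in> {1..r}" for i
    using assms(8) that by (auto simp: partition_index_def poset_interval_def interval_partition_def)
  then have "fst ` ?T = {1..r}"
    by (force simp: partition_index_def)
  moreover have "(\<lambda>t. card (snd (partition_family J g d t))) ` ?T = (\<lambda>i. rho g (d i)) ` fst ` ?T"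
    by (simp add: image_image partition_family_def rho_def case_prod_beta')
  ultimately show "sdepth ?T (partition_family J g d) = Min ((\<lambda>i. rho g (d i)) ` {1..r})"
    by (simp add: sdepth_def)
qed

end
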